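(* Let $C$ be an IS-category with subcategories $I_C$ (insertions) and $S_C$ (surjections). Then: (a) $C$ is an ordered category under its I-order $\leq_I$; (b) $S_C$ (with the I-order inherited from $C$) is an ordered category with restrictions, which is left cancellative if $C$ is regular; (c) viewing $S_C$ as a constellation with range $S'_C$ (with product $s\cdot t=s\circ(R(s)|t)$ whenever $R(s)\leq_I D(t)$), which is left cancellative if $C$ is regular, the mapping $\rho:C\to S'_C$ given by $a\rho=s_a$ is a canonical radiant; (d) there is an isomorphism of categories $\psi:C\to C(S'_C)$ onto the canonical extension of $S'_C$ such that $S_C\psi=C_S(S'_C)$ and $I_C\psi=C_I(S'_C)$.
   Context: Categories (object-free). A category is a class $C$ with a partial binary operation $\circ$ such that: (C1) $x\circ(y\circ z)$ exists iff $(x\circ y)\circ z$ exists, and then they are equal; (C2) if $x\circ y$ and $y\circ z$ exist then so does $x\circ(y\circ z)$; (C3) for each $x$ there are identities $e,f$ with $e\circ x$ and $x\circ f$ existing (an identity is an $e$ with $x\circ e=x$ whenever $x\circ e$ exists and $e\circ x=x$ whenever $e\circ x$ exists). These $e,f$ are unique and written $D(x)=e$, $R(x)=f$; $x\circ y$ exists iff $R(x)=D(y)$. $D(C)=\{D(x)\mid x\in C\}$. Compositions are read left to right, so $s$ is an epimorphism if $s\circ x=s\circ y$ implies $x=y$. A category is left cancellative if all its elements are epimorphisms. Functions are written on the right of their arguments. IS-categories. An IS-category is a category $C$ with subcategories $I_C$ and $S_C$, each containing $D(C)$, such that (IS1) for $e,f\in D(C)$ there is at most one $i\in I_C$ such that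 either ($D(i)=e$ and $R(i)=f$) or ($D(i)=f$ and $R(i)=e$); (IS2) for all $a\in C$ there are unique $s_a\in S_C$ and $i_a\in I_C$ with $a=s_a\circ i_a$. It is regular if $S_C$ consists of epimorphisms of $C$. The I-order: $s\leq_I t$ iff there are $i,j\in I_C$ such that $s\circ i$ and $j\circ t$ exist and are equal. Orders. An ordered category is a category with a partial order $\leq$ such that: (O1) if $a\leq b$, $c\leq d$ and $a\circ c$, $b\circ d$ exist then $a\circ c\leq b\circ d$; (O2) $a\leq b$ implies $D(a)\leq D(b)$; (O2$'$) $a\leq b$ implies $R(a)\leq R(b)$. It is an ordered category with restrictions if also (O3): if $e\in D(C)$ and $e\leq D(s)$, there is a unique $x\leq s$ with $D(x)=e$, denoted $e|s$. For any ordered category with restrictions, setting $s\cdot t=s\circ(R(s)|t)$ whenever $R(s)\leq D(t)$ (undefined otherwise) gives a constellation with range with the same $D,R$. Constellations. A constellation is a class $Q$ with a partial binary operation $\cdot$ such that: (Q1) if $x\cdot(y\cdot z)$ exists then $(x\cdot y)\cdot z$ exists and they are equal; (Q2) if $x\cdot y$ and $y\cdot z$ exist then so does $x\cdot(y\cdot z)$; (Q3) for each $x\in Q$ there is a unique right identity $e$ with $e\cdot x=x$ (a right identity is an $e$ with $x\cdot e=x$ whenever $x\cdot e$ exists); put $D(x)=e$, $D(Q)=\{D(x)\mid x\in Q\}$. For $e,f\in D(Q)$, $e\leq f$ iff $e\cdot f$ exists. A constellation with range is a constellation in which for each $s$ the set $\{e\in D(Q)\mid s\cdot e\text{ exists,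 and for all }f\in D(Q),\ s\cdot f\text{ exists implies }e\leq f\}$ has exactly one element, $R(s)$, and $R(R(s)\cdot t)=R(s\cdot t)$ whenever $s\cdot t$ exists; it is left cancellative if $a\cdot b=a\cdot c$ implies $R(a)\cdot b=R(a)\cdot c$. Every category is a constellation under $\circ$. Radiants. A radiant $\rho:P\to Q$ between constellations is a function with $D(s\rho)=D(s)\rho$ and such that if $s\cdot t$ exists then $(s\rho)\cdot(t\rho)$ exists and equals $(s\cdot t)\rho$. It is full if whenever $(s\rho)\cdot(t\rho)$ exists and lies in the image of $\rho$, there are $s',t'\in P$ with $s\rho=s'\rho$, $t\rho=t'\rho$ and $s'\cdot t'$ existing. A radiant $\rho$ from a category $C$ to a constellation is canonical if it is full, surjective, and for all $a,b\in C$: $a\rho=b\rho$ implies $D(a)=D(b)$; and $a\rho=b\rho$ together with $R(a)=R(b)$ implies $a=b$. Canonical extension. For a constellation $Q$, $C(Q)=\{(s,e)\mid s\in Q,\ e\in D(Q),\ s\cdot e\text{ exists}\}$ is the category with $D((s,e))=(D(s),D(s))$, $R((s,e))=(e,e)$ and $(s,e)\circ(t,f)=(s\cdot t,f)$ when $e=D(t)$. Put $C_I(Q)=\{(e,f)\mid e,f\in D(Q),\ e\cdot f\text{ exists}\}$ and, for $Q$ with range, $C_S(Q)=\{(s,R(s))\mid s\in Q\}$. *)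

theory Defs
  imports Main
begin

section \<open>Partial binary operations\<close>

text \<open>
  A partial binary operation is an option-valued function: \<open>mult M x y = Some z\<close> says that the
  product of \<open>x\<close> and \<open>y\<close> exists and is \<open>z\<close>.  The predicate \<open>partial_magma\<close> requires products to be
  undefined outside the carrier, so that existence of a product implies membership of its factors.
\<close>

record 'a partial_magma =
  carrier :: "'a set"
  mult :: "'a \<Rightarrow> 'a \<Rightarrow> 'a option"

definition partial_magma :: "'a partial_magma \<Rightarrow> bool" where
  "partial_magma M \<longleftrightarrow>
     (\<forall>x y z. mult M x y = Some z \<longrightarrow> x \<in> carrier M \<and> y \<in> carrier M \<and> z \<in> carrier M)"

definition defined :: "'a partial_magma \<Rightarrow> 'a \<Rightarrow> 'a \<Rightarrow> bool" where
  "defined M x y \<longleftrightarrow> mult M x y \<noteq> None"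

text \<open>The two bracketings of a triple product; \<open>None\<close> if any product involved is undefined.\<close>

definition mult_left :: "'a partial_magma \<Rightarrow> 'a \<Rightarrow> 'a \<Rightarrow> 'a \<Rightarrow> 'a option" where
  "mult_left M x y z = Option.bind (mult M x y) (\<lambda>u. mult M u z)"

definition mult_right :: "'a partial_magma \<Rightarrow> 'a \<Rightarrow> 'a \<Rightarrow> 'a \<Rightarrow> 'a option" where
  "mult_right M x y z = Option.bind (mult M y z) (\<lambda>u. mult M x u)"

definition restrict_to :: "'a partial_magma \<Rightarrow> 'a set \<Rightarrow> 'a partial_magma" where
  "restrict_to M A =
     \<lparr>carrier = A, mult = (\<lambda>x y. if x \<in> A \<and> y \<in> A then mult M x y else None)\<rparr>"


section \<open>Categories\<close>

definition identity :: "'a partial_magma \<Rightarrow> 'a \<Rightarrow> bool" where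
  "identity C e \<longleftrightarrow> e \<in> carrier C \<and>
     (\<forall>x. defined C x e \<longrightarrow> mult C x e = Some x) \<and>
     (\<forall>x. defined C e x \<longrightarrow> mult C e x = Some x)"

definition category :: "'a partial_magma \<Rightarrow> bool" where
  "category C \<longleftrightarrow> partial_magma C \<and>
     (\<forall>x\<in>carrier C. \<forall>y\<in>carrier C. \<forall>z\<in>carrier C. mult_right C x y z = mult_left C x y z) \<and>
     (\<forall>x\<in>carrier C. \<forall>y\<in>carrier C. \<forall>z\<in>carrier C.
        defined C x y \<and> defined C y z \<longrightarrow> mult_right C x y z \<noteq> None) \<and>
     (\<forall>x\<in>carrier C. \<exists>e f. identity C e \<and> identity C f \<and> defined C e x \<and> defined C x f)"

definition cat_D :: "'a partial_magma \<Rightarrow> 'a \<Rightarrow> 'a" where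
  "cat_D C x = (THE e. identity C e \<and> defined C e x)"

definition cat_R :: "'a partial_magma \<Rightarrow> 'a \<Rightarrow> 'a" where
  "cat_R C x = (THE f. identity C f \<and> defined C x f)"

definition cat_Ds :: "'a partial_magma \<Rightarrow> 'a set" where
  "cat_Ds C = cat_D C ` carrier C"

text \<open>Composition is read left to right, so epimorphisms cancel on the left.\<close>

definition epimorphism :: "'a partial_magma \<Rightarrow> 'a \<Rightarrow> bool" where
  "epimorphism C s \<longleftrightarrow> s \<in> carrier C \<and>
     (\<forall>x y z. mult C s x = Some z \<and> mult C s y = Some z \<longrightarrow> x = y)"

definition left_cancellative_category :: "'a partial_magma \<Rightarrow> bool" where
  "left_cancellative_category C \<longleftrightarrow> category C \<and> (\<forall>s\<in>carrier C. epimorphism C s)"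

definition subcategory :: "'a partial_magma \<Rightarrow> 'a set \<Rightarrow> bool" where
  "subcategory C A \<longleftrightarrow> A \<subseteq> carrier C \<and>
     (\<forall>x\<in>A. \<forall>y\<in>A. \<forall>z. mult C x y = Some z \<longrightarrow> z \<in> A) \<and>
     (\<forall>x\<in>A. cat_D C x \<in> A \<and> cat_R C x \<in> A)"

definition category_iso ::
  "'a partial_magma \<Rightarrow> 'b partial_magma \<Rightarrow> ('a \<Rightarrow> 'b) \<Rightarrow> bool" where
  "category_iso C C' \<psi> \<longleftrightarrow> category C \<and> category C' \<and>
     bij_betw \<psi> (carrier C) (carrier C') \<and>
     (\<forall>x\<in>carrier C. \<forall>y\<in>carrier C. mult C' (\<psi> x) (\<psi> y) = map_option \<psi> (mult C x y))"


section \<open>IS-categories\<close>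

definition IS_category :: "'a partial_magma \<Rightarrow> 'a set \<Rightarrow> 'a set \<Rightarrow> bool" where
  "IS_category C I S \<longleftrightarrow> category C \<and>
     subcategory C I \<and> cat_Ds C \<subseteq> I \<and>
     subcategory C S \<and> cat_Ds C \<subseteq> S \<and>
     (\<forall>e\<in>cat_Ds C. \<forall>f\<in>cat_Ds C. \<forall>i\<in>I. \<forall>j\<in>I.
        (cat_D C i = e \<and> cat_R C i = f \<or> cat_D C i = f \<and> cat_R C i = e) \<and>
        (cat_D C j = e \<and> cat_R C j = f \<or> cat_D C j = f \<and> cat_R C j = e) \<longrightarrow> i = j) \<and>
     (\<forall>a\<in>carrier C. \<exists>!(s, i). s \<in> S \<and> i \<in> I \<and> mult C s i = Some a)"

definition IS_regular :: "'a partial_magma \<Rightarrow> 'a set \<Rightarrow> bool" where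
  "IS_regular C S \<longleftrightarrow> (\<forall>s\<in>S. epimorphism C s)"

definition surjection_part :: "'a partial_magma \<Rightarrow> 'a set \<Rightarrow> 'a set \<Rightarrow> 'a \<Rightarrow> 'a" where
  "surjection_part C I S a = fst (THE (s, i). s \<in> S \<and> i \<in> I \<and> mult C s i = Some a)"

definition I_order :: "'a partial_magma \<Rightarrow> 'a set \<Rightarrow> 'a rel" where
  "I_order C I = {(s, t). s \<in> carrier C \<and> t \<in> carrier C \<and>
     (\<exists>i\<in>I. \<exists>j\<in>I. \<exists>u. mult C s i = Some u \<and> mult C j t = Some u)}"


section \<open>Ordered categories\<close>

definition ordered_category :: "'a partial_magma \<Rightarrow> 'a rel \<Rightarrow> bool" where
  "ordered_category C r \<longleftrightarrow> category C \<and> partial_order_on (carrier C) r \<and>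
     (\<forall>a b c d u v. (a, b) \<in> r \<and> (c, d) \<in> r \<and> mult C a c = Some u \<and> mult C b d = Some v
        \<longrightarrow> (u, v) \<in> r) \<and>
     (\<forall>a b. (a, b) \<in> r \<longrightarrow> (cat_D C a, cat_D C b) \<in> r) \<and>
     (\<forall>a b. (a, b) \<in> r \<longrightarrow> (cat_R C a, cat_R C b) \<in> r)"

definition ordered_category_with_restrictions :: "'a partial_magma \<Rightarrow> 'a rel \<Rightarrow> bool" where
  "ordered_category_with_restrictions C r \<longleftrightarrow> ordered_category C r \<and>
     (\<forall>s\<in>carrier C. \<forall>e\<in>cat_Ds C. (e, cat_D C s) \<in> r
        \<longrightarrow> (\<exists>!x. (x, s) \<in> r \<and> cat_D C x = e))"

definition restriction :: "'a partial_magma \<Rightarrow> 'a rel \<Rightarrow> 'a \<Rightarrow> 'a \<Rightarrow> 'a" where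
  "restriction C r e s = (THE x. (x, s) \<in> r \<and> cat_D C x = e)"

definition to_constellation :: "'a partial_magma \<Rightarrow> 'a rel \<Rightarrow> 'a partial_magma" where
  "to_constellation C r =
     \<lparr>carrier = carrier C,
      mult = (\<lambda>s t. if s \<in> carrier C \<and> t \<in> carrier C \<and> (cat_R C s, cat_D C t) \<in> r
                     then mult C s (restriction C r (cat_R C s) t) else None)\<rparr>"


section \<open>Constellations\<close>

definition right_identity :: "'a partial_magma \<Rightarrow> 'a \<Rightarrow> bool" where
  "right_identity Q e \<longleftrightarrow> e \<in> carrier Q \<and> (\<forall>x. defined Q x e \<longrightarrow> mult Q x e = Some x)"

definition constellation :: "'a partial_magma \<Rightarrow> bool" where
  "constellation Q \<longleftrightarrow> partial_magma Q \<and>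
     (\<forall>x\<in>carrier Q. \<forall>y\<in>carrier Q. \<forall>z\<in>carrier Q.
        mult_right Q x y z \<noteq> None \<longrightarrow> mult_left Q x y z = mult_right Q x y z) \<and>
     (\<forall>x\<in>carrier Q. \<forall>y\<in>carrier Q. \<forall>z\<in>carrier Q.
        defined Q x y \<and> defined Q y z \<longrightarrow> mult_right Q x y z \<noteq> None) \<and>
     (\<forall>x\<in>carrier Q. \<exists>!e. right_identity Q e \<and> mult Q e x = Some x)"

definition con_D :: "'a partial_magma \<Rightarrow> 'a \<Rightarrow> 'a" where
  "con_D Q x = (THE e. right_identity Q e \<and> mult Q e x = Some x)"

definition con_Ds :: "'a partial_magma \<Rightarrow> 'a set" where
  "con_Ds Q = con_D Q ` carrier Q"

text \<open>On \<open>con_Ds Q\<close> the order \<open>e \<le> f\<close> is \<open>defined Q e f\<close>.\<close>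

definition range_candidates :: "'a partial_magma \<Rightarrow> 'a \<Rightarrow> 'a set" where
  "range_candidates Q s =
     {e \<in> con_Ds Q. defined Q s e \<and> (\<forall>f\<in>con_Ds Q. defined Q s f \<longrightarrow> defined Q e f)}"

definition con_R :: "'a partial_magma \<Rightarrow> 'a \<Rightarrow> 'a" where
  "con_R Q s = (THE e. e \<in> range_candidates Q s)"

definition constellation_with_range :: "'a partial_magma \<Rightarrow> bool" where
  "constellation_with_range Q \<longleftrightarrow> constellation Q \<and>
     (\<forall>s\<in>carrier Q. \<exists>!e. e \<in> range_candidates Q s) \<and>
     (\<forall>s t u. mult Q s t = Some u
        \<longrightarrow> (\<exists>v. mult Q (con_R Q s) t = Some v \<and> con_R Q v = con_R Q u))"

definition left_cancellative_constellation :: "'a partial_magma \<Rightarrow> bool" where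
  "left_cancellative_constellation Q \<longleftrightarrow> constellation_with_range Q \<and>
     (\<forall>a b c u. mult Q a b = Some u \<and> mult Q a c = Some u
        \<longrightarrow> (\<exists>v. mult Q (con_R Q a) b = Some v \<and> mult Q (con_R Q a) c = Some v))"


section \<open>Radiants\<close>

definition radiant ::
  "'a partial_magma \<Rightarrow> 'b partial_magma \<Rightarrow> ('a \<Rightarrow> 'b) \<Rightarrow> bool" where
  "radiant P Q \<rho> \<longleftrightarrow> constellation P \<and> constellation Q \<and> \<rho> ` carrier P \<subseteq> carrier Q \<and>
     (\<forall>s\<in>carrier P. con_D Q (\<rho> s) = \<rho> (con_D P s)) \<and>
     (\<forall>s t u. mult P s t = Some u \<longrightarrow> mult Q (\<rho> s) (\<rho> t) = Some (\<rho> u))"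

definition full_radiant ::
  "'a partial_magma \<Rightarrow> 'b partial_magma \<Rightarrow> ('a \<Rightarrow> 'b) \<Rightarrow> bool" where
  "full_radiant P Q \<rho> \<longleftrightarrow> radiant P Q \<rho> \<and>
     (\<forall>s\<in>carrier P. \<forall>t\<in>carrier P. \<forall>u\<in>\<rho> ` carrier P. mult Q (\<rho> s) (\<rho> t) = Some u
        \<longrightarrow> (\<exists>s'\<in>carrier P. \<exists>t'\<in>carrier P. \<rho> s = \<rho> s' \<and> \<rho> t = \<rho> t' \<and> defined P s' t'))"

definition canonical_radiant ::
  "'a partial_magma \<Rightarrow> 'b partial_magma \<Rightarrow> ('a \<Rightarrow> 'b) \<Rightarrow> bool" where
  "canonical_radiant C Q \<rho> \<longleftrightarrow> category C \<and> full_radiant C Q \<rho> \<and> \<rho> ` carrier C = carrier Q \<and>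
     (\<forall>a\<in>carrier C. \<forall>b\<in>carrier C. \<rho> a = \<rho> b \<longrightarrow> cat_D C a = cat_D C b) \<and>
     (\<forall>a\<in>carrier C. \<forall>b\<in>carrier C. \<rho> a = \<rho> b \<and> cat_R C a = cat_R C b \<longrightarrow> a = b)"


section \<open>The canonical extension of a constellation\<close>

definition canonical_extension :: "'a partial_magma \<Rightarrow> ('a \<times> 'a) partial_magma" where
  "canonical_extension Q =
     restrict_to
       \<lparr>carrier = UNIV,
        mult = (\<lambda>(s, e) (t, f).
          if e = con_D Q t then map_option (\<lambda>u. (u, f)) (mult Q s t) else None)\<rparr>
       {(s, e). s \<in> carrier Q \<and> e \<in> con_Ds Q \<and> defined Q s e}"

definition extension_I :: "'a partial_magma \<Rightarrow> ('a \<times> 'a) set" where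
  "extension_I Q = {(e, f). e \<in> con_Ds Q \<and> f \<in> con_Ds Q \<and> defined Q e f}"

definition extension_S :: "'a partial_magma \<Rightarrow> ('a \<times> 'a) set" where
  "extension_S Q = {(s, con_R Q s) | s. s \<in> carrier Q}"


section \<open>The surjections of an IS-category\<close>

definition surjection_category :: "'a partial_magma \<Rightarrow> 'a set \<Rightarrow> 'a partial_magma" where
  "surjection_category C S = restrict_to C S"

definition surjection_order :: "'a partial_magma \<Rightarrow> 'a set \<Rightarrow> 'a set \<Rightarrow> 'a rel" where
  "surjection_order C I S = I_order C I \<inter> S \<times> S"

definition surjection_constellation ::
  "'a partial_magma \<Rightarrow> 'a set \<Rightarrow> 'a set \<Rightarrow> 'a partial_magma" where
  "surjection_constellation C I S =
     to_constellation (surjection_category C S) (surjection_order C I S)"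

end

theory Submission
  imports Defs
begin

text \<open>
  Write \<open>\<rho> a = s\<^sub>a\<close>. Uniqueness of factorizations gives \<open>\<rho> (s \<circ> a) = s \<circ> \<rho> a\<close> for a surjection \<open>s\<close>
  and \<open>\<rho> (a \<circ> \<rho> b) = \<rho> (a \<circ> b)\<close>. If \<open>i\<close> is the unique insertion from \<open>e\<close> to \<open>D s\<close>, then \<open>e|s\<close> is
  \<open>\<rho> (i \<circ> s)\<close>; hence the constellation product is \<open>s \<cdot> t = \<rho> (s \<circ> i \<circ> t)\<close> with \<open>i\<close> the insertion from
  \<open>R s\<close> to \<open>D t\<close>, and \<open>\<rho> a \<cdot> \<rho> b = \<rho> (a \<circ> b)\<close>. The isomorphism is \<open>\<psi> a = (\<rho> a, R a)\<close>; it is injective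
  because an insertion is determined by its endpoints. That the canonical extension is a category
  follows by transport along \<open>\<psi>\<close>.
\<close>

section \<open>Categories with a total composition\<close>

locale cat =
  fixes C :: "'a partial_magma"
  assumes category: "category C"
begin

abbreviation D :: "'a \<Rightarrow> 'a" where "D \<equiv> cat_D C"
abbreviation R :: "'a \<Rightarrow> 'a" where "R \<equiv> cat_R C"

text \<open>Total composition turns composites into ordinary terms for rewriting. Off the domain its
  value is the unspecified \<open>the None\<close>, so laws for arbitrary factors assume
  \<open>R x = D y\<close>.\<close>

definition comp :: "'a \<Rightarrow> 'a \<Rightarrow> 'a" (infixl "\<odot>" 70) where
  "x \<odot> y = the (mult C x y)"

lemma mult_closed:
  assumes "mult C x y = Some z"
  shows "x \<in> carrier C" "y \<in> carrier C" "z \<in> carrier C"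
  using assms category unfolding category_def partial_magma_def by blast+

text \<open>The axiom concerns elements of the carrier; for other arguments both bracketings are
  \<open>None\<close>, since a defined product has its factors and its value in the carrier.\<close>

lemma mult_assoc: "mult_right C x y z = mult_left C x y z"
proof (cases "x \<in> carrier C \<and> y \<in> carrier C \<and> z \<in> carrier C")
  case True
  then show ?thesis using category unfolding category_def by blast
next
  case False
  have "mult_right C x y z = None"
    using False mult_closed unfolding mult_right_def
    by (metis bind_eq_None_conv not_Some_eq option.sel)
  moreover have "mult_left C x y z = None"
    using False mult_closed unfolding mult_left_def
    by (metis bind_eq_None_conv not_Some_eq option.sel)
  ultimately show ?thesis by simp
qed

text \<open>If one bracketing is defined, so is the inner product of the other. Inserting an
  identity and reassociating thus yields new defined products.\<close>

lemma mult_assoc_Some: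
  "mult C y z = Some u \<Longrightarrow> mult C x u = Some v \<Longrightarrow> \<exists>w. mult C x y = Some w \<and> mult C w z = Some v"
  "mult C x y = Some w \<Longrightarrow> mult C w z = Some v \<Longrightarrow> \<exists>u. mult C y z = Some u \<and> mult C x u = Some v"
proof -
  have "mult_right C x y z = Some v \<longleftrightarrow> mult_left C x y z = Some v"
    using mult_assoc by simp
  then have *: "(\<exists>u. mult C y z = Some u \<and> mult C x u = Some v) \<longleftrightarrow>
      (\<exists>w. mult C x y = Some w \<and> mult C w z = Some v)"
    unfolding mult_right_def mult_left_def bind_eq_Some_conv .
  show "mult C y z = Some u \<Longrightarrow> mult C x u = Some v \<Longrightarrow> \<exists>w. mult C x y = Some w \<and> mult C w z = Some v"
    using * by blast
  show "mult C x y = Some w \<Longrightarrow> mult C w z = Some v \<Longrightarrow> \<exists>u. mult C y z = Some u \<and> mult C x u = Some v"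
    using * by blast
qed

lemma identity_left: "identity C e \<Longrightarrow> mult C e x = Some y \<Longrightarrow> y = x"
  and identity_right: "identity C e \<Longrightarrow> mult C x e = Some y \<Longrightarrow> y = x"
  unfolding identity_def defined_def by (metis option.distinct(1) option.inject)+

lemma defined_identity_left: "identity C e \<Longrightarrow> defined C e x \<Longrightarrow> mult C e x = Some x"
  and defined_identity_right: "identity C e \<Longrightarrow> defined C x e \<Longrightarrow> mult C x e = Some x"
  unfolding identity_def by blast+

section \<open>Domains, codomains and composability\<close>

lemma identities_composable_eq:
  assumes "identity C e" "identity C f" "mult C e f = Some z"
  shows "e = f"
  using assms identity_left identity_right by blast

text \<open>Both identities fix \<open>x\<close>, so \<open>f (e x)\<close> is defined;
  reassociating makes \<open>f e\<close> defined, and composable identities coincide.\<close>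

lemma left_identity_unique:
  assumes "identity C e" "identity C f" "defined C e x" "defined C f x"
  shows "e = f"
proof -
  have "mult C e x = Some x" "mult C f x = Some x"
    using assms defined_identity_left by blast+
  then obtain w where "mult C f e = Some w" using mult_assoc_Some(1) by metis
  then show ?thesis using assms identities_composable_eq by metis
qed

lemma right_identity_unique:
  assumes "identity C e" "identity C f" "defined C x e" "defined C x f"
  shows "e = f"
proof -
  have "mult C x e = Some x" "mult C x f = Some x"
    using assms defined_identity_right by blast+
  then obtain w where "mult C e f = Some w" using mult_assoc_Some(2) by metis
  then show ?thesis using assms identities_composable_eq by metis
qed

lemma D_eqI: "identity C e \<Longrightarrow> defined C e x \<Longrightarrow> D x = e"
  unfolding cat_D_def by (rule the_equality) (auto intro: left_identity_unique)

lemma R_eqI: "identity C e \<Longrightarrow> defined C x e \<Longrightarrow> R x = e"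
  unfolding cat_R_def by (rule the_equality) (auto intro: right_identity_unique)

lemma
  assumes "x \<in> carrier C"
  shows identity_D: "identity C (D x)" and identity_R: "identity C (R x)"
    and mult_D: "mult C (D x) x = Some x" and mult_R: "mult C x (R x) = Some x"
proof -
  obtain e f where ef: "identity C e" "identity C f" "defined C e x" "defined C x f"
    using assms category unfolding category_def by blast
  then have "D x = e" "R x = f" using D_eqI R_eqI by auto
  with ef show "identity C (D x)" "identity C (R x)"
    "mult C (D x) x = Some x" "mult C x (R x) = Some x"
    using defined_identity_left defined_identity_right by blast+
qed

lemma D_closed [simp]: "x \<in> carrier C \<Longrightarrow> D x \<in> carrier C"
  and R_closed [simp]: "x \<in> carrier C \<Longrightarrow> R x \<in> carrier C"
  using identity_D identity_R unfolding identity_def by auto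

lemma identity_D_eq: "identity C e \<Longrightarrow> D e = e"
  and identity_R_eq: "identity C e \<Longrightarrow> R e = e"
proof -
  assume e: "identity C e"
  then have c: "e \<in> carrier C" unfolding identity_def by blast
  show "D e = e" using mult_D[OF c] identity_D[OF c] e identities_composable_eq by blast
  show "R e = e" using mult_R[OF c] identity_R[OF c] e identities_composable_eq by metis
qed

lemma D_D [simp]: "x \<in> carrier C \<Longrightarrow> D (D x) = D x"
  and R_D [simp]: "x \<in> carrier C \<Longrightarrow> R (D x) = D x"
  and D_R [simp]: "x \<in> carrier C \<Longrightarrow> D (R x) = R x"
  and R_R [simp]: "x \<in> carrier C \<Longrightarrow> R (R x) = R x"
  using identity_D identity_R identity_D_eq identity_R_eq by auto

text \<open>Writing \<open>y\<close> as \<open>D y\<close> followed by \<open>y\<close> and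
  reassociating shows that \<open>x\<close> composes with \<open>D y\<close>, which is therefore the
  right identity of \<open>x\<close>.\<close>

lemma mult_Some_R_eq_D:
  assumes "mult C x y = Some z"
  shows "R x = D y"
proof -
  have c: "x \<in> carrier C" "y \<in> carrier C" using mult_closed assms by auto
  obtain w where "mult C x (D y) = Some w"
    using mult_assoc_Some(1)[OF mult_D[OF c(2)] assms] by blast
  then show ?thesis using R_eqI[OF identity_D[OF c(2)]] unfolding defined_def by auto
qed

text \<open>The identity \<open>R x\<close> composes with \<open>x\<close> on one side and with
  \<open>y\<close> on the other, so the axiom on composable chains makes \<open>x (R x y)\<close>
  defined, where \<open>R x y\<close> is \<open>y\<close>.\<close>

lemma mult_comp:
  assumes "x \<in> carrier C" "y \<in> carrier C" "R x = D y"
  shows "mult C x y = Some (x \<odot> y)"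
proof -
  have "defined C x (R x)" "defined C (R x) y"
    using mult_R mult_D assms unfolding defined_def by fastforce+
  then have "mult_right C x (R x) y \<noteq> None"
    using category assms(1,2) R_closed unfolding category_def by blast
  then show ?thesis
    using mult_D[OF assms(2)] assms(3) unfolding mult_right_def comp_def by auto
qed

lemma mult_eq_Some_iff:
  "mult C x y = Some z \<longleftrightarrow> x \<in> carrier C \<and> y \<in> carrier C \<and> R x = D y \<and> z = x \<odot> y"
  using mult_comp mult_closed mult_Some_R_eq_D by (metis option.inject)

lemma mult_conv:
  "mult C x y = (if x \<in> carrier C \<and> y \<in> carrier C \<and> R x = D y then Some (x \<odot> y) else None)"
proof (cases "mult C x y")
  case None
  then show ?thesis using mult_comp[of x y] by auto
next
  case (Some z)
  then show ?thesis by (simp add: mult_eq_Some_iff)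
qed

lemma comp_closed [simp]: "x \<in> carrier C \<Longrightarrow> y \<in> carrier C \<Longrightarrow> R x = D y \<Longrightarrow> x \<odot> y \<in> carrier C"
  using mult_comp mult_closed by blast

lemma D_left [simp]: "x \<in> carrier C \<Longrightarrow> D x \<odot> x = x"
  and R_right [simp]: "x \<in> carrier C \<Longrightarrow> x \<odot> R x = x"
  using mult_D mult_R unfolding comp_def by auto

lemma
  assumes "x \<in> carrier C" "y \<in> carrier C" "R x = D y"
  shows D_comp [simp]: "D (x \<odot> y) = D x" and R_comp [simp]: "R (x \<odot> y) = R y"
proof -
  have m: "mult C x y = Some (x \<odot> y)" using assms mult_comp by blast
  obtain u where "mult C (D x) (x \<odot> y) = Some u"
    using mult_assoc_Some(2)[OF mult_D[OF assms(1)] m] m by auto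
  then show "D (x \<odot> y) = D x" using mult_Some_R_eq_D assms(1) by (metis R_D)
  obtain v where "mult C (x \<odot> y) (R y) = Some v"
    using mult_assoc_Some(1)[OF mult_R[OF assms(2)] m] m by auto
  then show "R (x \<odot> y) = R y" using mult_Some_R_eq_D assms(2) by (metis D_R)
qed

lemma comp_assoc:
  assumes "x \<in> carrier C" "y \<in> carrier C" "z \<in> carrier C" "R x = D y" "R y = D z"
  shows "x \<odot> y \<odot> z = x \<odot> (y \<odot> z)"
proof -
  have "mult C x y = Some (x \<odot> y)" "mult C (x \<odot> y) z = Some (x \<odot> y \<odot> z)"
    using assms by (auto simp: mult_eq_Some_iff)
  then show ?thesis using mult_assoc_Some(2) by (fastforce simp: mult_eq_Some_iff)
qed

section \<open>A category as a constellation\<close>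

lemma cat_Ds_iff: "e \<in> cat_Ds C \<longleftrightarrow> e \<in> carrier C \<and> D e = e"
  unfolding cat_Ds_def by (metis D_D D_closed image_iff)

text \<open>For a right identity \<open>e\<close>, the product of \<open>D e\<close> and
  \<open>e\<close> equals both \<open>e\<close> and \<open>D e\<close>. So the two notions of domain
  agree on a category.\<close>

lemma right_identity_iff: "right_identity C e \<longleftrightarrow> e \<in> carrier C \<and> D e = e"
proof
  assume e: "right_identity C e"
  then have c: "e \<in> carrier C" unfolding right_identity_def by blast
  then have "mult C (D e) e = Some (D e)"
    using e mult_D unfolding right_identity_def defined_def by auto
  then show "e \<in> carrier C \<and> D e = e" using c mult_D by simp
next
  assume e: "e \<in> carrier C \<and> D e = e"
  then show "right_identity C e"
    using identity_D unfolding right_identity_def identity_def by metis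
qed

lemma right_identity_mult_iff:
  assumes "x \<in> carrier C"
  shows "right_identity C e \<and> mult C e x = Some x \<longleftrightarrow> e = D x"
proof
  assume *: "right_identity C e \<and> mult C e x = Some x"
  then have "R e = D x" by (simp add: mult_eq_Some_iff)
  with * show "e = D x" unfolding right_identity_iff by (metis R_D)
qed (use assms mult_D in \<open>simp add: right_identity_iff\<close>)

lemma con_D_eq: "x \<in> carrier C \<Longrightarrow> con_D C x = D x"
  unfolding con_D_def by (rule the_equality) (auto simp: right_identity_mult_iff)

lemma constellation: "constellation C"
  unfolding constellation_def
  using category mult_assoc unfolding category_def
  by (auto simp: right_identity_mult_iff)

text \<open>The elements \<open>D x\<close> and \<open>R x\<close> lie in \<open>A\<close> and
  remain identities there, so domains and codomains do not change on passing to the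
  subcategory.\<close>

lemma subcategory_cat:
  assumes "subcategory C A"
  shows "category (restrict_to C A)"
    and "x \<in> A \<Longrightarrow> cat_D (restrict_to C A) x = D x"
    and "x \<in> A \<Longrightarrow> cat_R (restrict_to C A) x = R x"
proof -
  let ?K = "restrict_to C A"
  have sub: "A \<subseteq> carrier C" and closed: "\<And>x y. x \<in> A \<Longrightarrow> y \<in> A \<Longrightarrow> R x = D y \<Longrightarrow> x \<odot> y \<in> A"
    and DR: "\<And>x. x \<in> A \<Longrightarrow> D x \<in> A \<and> R x \<in> A"
    using assms mult_comp unfolding subcategory_def by (blast, blast, blast)
  have [simp]: "\<And>x. x \<in> A \<Longrightarrow> x \<in> carrier C" "carrier ?K = A"
    using sub by (auto simp: restrict_to_def)
  have m: "mult ?K x y = (if x \<in> A \<and> y \<in> A \<and> R x = D y then Some (x \<odot> y) else None)" for x y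
    by (auto simp: restrict_to_def mult_conv)
  have id: "identity ?K (D x)" "identity ?K (R x)" if "x \<in> A" for x
  proof -
    have "y = D x \<odot> y" if "y \<in> A" "D x = D y" for y
      using that by simp
    moreover have "y = y \<odot> R x" if "y \<in> A" "R y = R x" for y
      using that by (metis R_right \<open>\<And>x. x \<in> A \<Longrightarrow> x \<in> carrier C\<close>)
    moreover have "y = R x \<odot> y" if "y \<in> A" "R x = D y" for y
      using that by simp
    moreover have "y = y \<odot> D x" if "y \<in> A" "R y = D x" for y
      using that by (metis R_right \<open>\<And>x. x \<in> A \<Longrightarrow> x \<in> carrier C\<close>)
    ultimately show "identity ?K (D x)" "identity ?K (R x)"
      using \<open>x \<in> A\<close> DR by (auto simp: identity_def defined_def m split: if_splits)
  qed
  have def: "defined ?K (D x) x" "defined ?K x (R x)" if "x \<in> A" for x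
    using that DR by (auto simp: defined_def m)
  show K: "category ?K"
    unfolding category_def
  proof (intro conjI)
    show "partial_magma ?K"
      unfolding partial_magma_def using closed by (auto simp: m split: if_splits)
    show "\<forall>x\<in>carrier ?K. \<forall>y\<in>carrier ?K. \<forall>z\<in>carrier ?K. mult_right ?K x y z = mult_left ?K x y z"
      using closed by (auto simp: mult_right_def mult_left_def m comp_assoc)
    show "\<forall>x\<in>carrier ?K. \<forall>y\<in>carrier ?K. \<forall>z\<in>carrier ?K.
        defined ?K x y \<and> defined ?K y z \<longrightarrow> mult_right ?K x y z \<noteq> None"
      using closed by (auto simp: mult_right_def defined_def m split: if_splits)
    show "\<forall>x\<in>carrier ?K. \<exists>e f. identity ?K e \<and> identity ?K f \<and> defined ?K e x \<and> defined ?K x f"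
      using id def by (metis \<open>carrier ?K = A\<close>)
  qed
  interpret K: cat ?K by unfold_locales (fact K)
  show "x \<in> A \<Longrightarrow> cat_D ?K x = D x" "x \<in> A \<Longrightarrow> cat_R ?K x = R x"
    using K.D_eqI K.R_eqI id def by auto
qed

end

text \<open>Each axiom for \<open>K\<close> is pulled back along the bijection, since
  \<open>mult\<close> matches definedness as well as values. For the canonical extension this
  replaces a direct check of the axioms.\<close>

lemma category_transport:
  assumes C: "category C" and K: "partial_magma K"
    and bij: "bij_betw \<psi> (carrier C) (carrier K)"
    and mult: "\<And>x y. x \<in> carrier C \<Longrightarrow> y \<in> carrier C \<Longrightarrow>
      mult K (\<psi> x) (\<psi> y) = map_option \<psi> (mult C x y)"
  shows "category_iso C K \<psi>"
proof -
  interpret cat C by unfold_locales (fact C)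
  have img: "carrier K = \<psi> ` carrier C"
    using bij by (auto simp: bij_betw_def)
  have right: "mult_right K (\<psi> x) (\<psi> y) (\<psi> z) = map_option \<psi> (mult_right C x y z)"
    and left: "mult_left K (\<psi> x) (\<psi> y) (\<psi> z) = map_option \<psi> (mult_left C x y z)"
    if "x \<in> carrier C" "y \<in> carrier C" "z \<in> carrier C" for x y z
    using that by (auto simp: mult_right_def mult_left_def mult mult_conv)
  have def: "defined K (\<psi> x) (\<psi> y) \<longleftrightarrow> defined C x y" if "x \<in> carrier C" "y \<in> carrier C" for x y
    using that by (simp add: defined_def mult)
  have mem: "x \<in> carrier K \<and> y \<in> carrier K" if "defined K x y" for x y
    using that K unfolding partial_magma_def defined_def by blast
  have id: "identity K (\<psi> e)" if "identity C e" for e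
  proof -
    have e: "e \<in> carrier C" using that unfolding identity_def by blast
    have "mult K x (\<psi> e) = Some x" if d: "defined K x (\<psi> e)" for x
    proof -
      obtain x' where "x' \<in> carrier C" "x = \<psi> x'" using mem[OF d] img by auto
      then show ?thesis using d \<open>identity C e\<close> e by (simp add: def mult identity_def)
    qed
    moreover have "mult K (\<psi> e) x = Some x" if d: "defined K (\<psi> e) x" for x
    proof -
      obtain x' where "x' \<in> carrier C" "x = \<psi> x'" using mem[OF d] img by auto
      then show ?thesis using d \<open>identity C e\<close> e by (simp add: def mult identity_def)
    qed
    ultimately show ?thesis using e img unfolding identity_def by blast
  qed
  have "\<exists>e f. identity K e \<and> identity K f \<and> defined K e (\<psi> x) \<and> defined K (\<psi> x) f"
    if "x \<in> carrier C" for x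
    using that category def id unfolding category_def by (metis identity_def)
  then have "category K"
    unfolding category_def img
    using K mult_assoc category by (auto simp: right left def category_def)
  then show ?thesis unfolding category_iso_def using C bij mult by blast
qed

section \<open>The constellation of an ordered category with restrictions\<close>

locale ordered_cat_restr = cat C for C :: "'a partial_magma" +
  fixes r :: "'a rel"
  assumes ordered_restr: "ordered_category_with_restrictions C r"
begin

abbreviation less_eq (infix "\<sqsubseteq>" 50) where "x \<sqsubseteq> y \<equiv> (x, y) \<in> r"
abbreviation restr (infixr "\<restriction>\<^sub>r" 75) where "e \<restriction>\<^sub>r s \<equiv> restriction C r e s"
abbreviation Q where "Q \<equiv> to_constellation C r"

lemma ordered: "ordered_category C r"
  using ordered_restr unfolding ordered_category_with_restrictions_def by blast

lemma
  shows le_closed: "x \<sqsubseteq> y \<Longrightarrow> x \<in> carrier C \<and> y \<in> carrier C"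
    and le_refl: "x \<in> carrier C \<Longrightarrow> x \<sqsubseteq> x"
    and le_trans: "x \<sqsubseteq> y \<Longrightarrow> y \<sqsubseteq> z \<Longrightarrow> x \<sqsubseteq> z"
    and le_antisym: "x \<sqsubseteq> y \<Longrightarrow> y \<sqsubseteq> x \<Longrightarrow> x = y"
proof -
  have "partial_order_on (carrier C) r" using ordered unfolding ordered_category_def by blast
  note po = partial_order_onD[OF this]
  show "x \<sqsubseteq> y \<Longrightarrow> x \<in> carrier C \<and> y \<in> carrier C" using po(4) by blast
  show "x \<in> carrier C \<Longrightarrow> x \<sqsubseteq> x" using po(1) by (rule refl_onD)
  show "x \<sqsubseteq> y \<Longrightarrow> y \<sqsubseteq> z \<Longrightarrow> x \<sqsubseteq> z" using po(2) by (rule transD)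
  show "x \<sqsubseteq> y \<Longrightarrow> y \<sqsubseteq> x \<Longrightarrow> x = y" using po(3) by (rule antisymD)
qed

lemma le_R: "x \<sqsubseteq> y \<Longrightarrow> R x \<sqsubseteq> R y"
  using ordered unfolding ordered_category_def by blast

lemma le_comp:
  assumes "a \<sqsubseteq> b" "c \<sqsubseteq> d" "R a = D c" "R b = D d"
  shows "a \<odot> c \<sqsubseteq> b \<odot> d"
proof -
  have "mult C a c = Some (a \<odot> c)" "mult C b d = Some (b \<odot> d)"
    using assms le_closed by (auto intro: mult_comp)
  then show ?thesis using ordered assms(1,2) unfolding ordered_category_def by blast
qed

section \<open>Restrictions and their behaviour under composition\<close>

lemma
  assumes "e \<in> carrier C" "D e = e" "e \<sqsubseteq> D s" "s \<in> carrier C"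
  shows restr_le: "e \<restriction>\<^sub>r s \<sqsubseteq> s" and D_restr [simp]: "D (e \<restriction>\<^sub>r s) = e"
    and restr_closed [simp]: "e \<restriction>\<^sub>r s \<in> carrier C"
    and restr_eqI: "x \<sqsubseteq> s \<Longrightarrow> D x = e \<Longrightarrow> e \<restriction>\<^sub>r s = x"
proof -
  have ex1: "\<exists>!x. x \<sqsubseteq> s \<and> D x = e"
    using ordered_restr assms cat_Ds_iff[of e] unfolding ordered_category_with_restrictions_def
    by blast
  show *: "e \<restriction>\<^sub>r s \<sqsubseteq> s" "D (e \<restriction>\<^sub>r s) = e"
    using theI'[OF ex1] unfolding restriction_def by auto
  show "x \<sqsubseteq> s \<Longrightarrow> D x = e \<Longrightarrow> e \<restriction>\<^sub>r s = x" using ex1 * by auto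
  show "e \<restriction>\<^sub>r s \<in> carrier C" using * le_closed by blast
qed

lemma restr_D [simp]:
  assumes "s \<in> carrier C" shows "D s \<restriction>\<^sub>r s = s"
  using assms by (intro restr_eqI) (auto simp: le_refl)

lemma restr_identity:
  assumes "e \<in> carrier C" "D e = e" "e \<sqsubseteq> f" "D f = f" "f \<in> carrier C"
  shows "e \<restriction>\<^sub>r f = e"
  using assms by (intro restr_eqI) auto

lemma R_restr_le:
  assumes "e \<in> carrier C" "D e = e" "e \<sqsubseteq> D s" "s \<in> carrier C"
  shows "R (e \<restriction>\<^sub>r s) \<sqsubseteq> R s"
  using assms restr_le le_R by blast

text \<open>By transitivity the iterated restriction lies below \<open>s\<close>, and its domain is
  \<open>e\<close>; only one element has both properties.\<close>

lemma restr_restr: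
  assumes "e \<in> carrier C" "D e = e" "f \<in> carrier C" "D f = f" "e \<sqsubseteq> f" "f \<sqsubseteq> D s" "s \<in> carrier C"
  shows "e \<restriction>\<^sub>r (f \<restriction>\<^sub>r s) = e \<restriction>\<^sub>r s"
proof -
  have f: "f \<restriction>\<^sub>r s \<in> carrier C" "D (f \<restriction>\<^sub>r s) = f" using assms by auto
  then have "e \<restriction>\<^sub>r (f \<restriction>\<^sub>r s) \<sqsubseteq> f \<restriction>\<^sub>r s" using assms by (intro restr_le) auto
  moreover have "f \<restriction>\<^sub>r s \<sqsubseteq> s" using assms by (intro restr_le)
  ultimately have "e \<restriction>\<^sub>r (f \<restriction>\<^sub>r s) \<sqsubseteq> s" using le_trans by blast
  moreover have "D (e \<restriction>\<^sub>r (f \<restriction>\<^sub>r s)) = e" using assms f by (intro D_restr) auto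
  moreover have "e \<sqsubseteq> D s" using assms le_trans by blast
  ultimately show ?thesis using assms restr_eqI by metis
qed

text \<open>The factors on the right lie below \<open>s\<close> and \<open>t\<close>, so their
  composite lies below \<open>s \<odot> t\<close>; its domain is \<open>e\<close>, and restrictions
  are unique.\<close>

lemma restr_comp:
  assumes e: "e \<in> carrier C" "D e = e" "e \<sqsubseteq> D s" and st: "s \<in> carrier C" "t \<in> carrier C" "R s = D t"
  shows "e \<restriction>\<^sub>r (s \<odot> t) = (e \<restriction>\<^sub>r s) \<odot> (R (e \<restriction>\<^sub>r s) \<restriction>\<^sub>r t)"
proof -
  let ?s = "e \<restriction>\<^sub>r s"
  have s: "?s \<in> carrier C" "?s \<sqsubseteq> s" "D ?s = e" using e st restr_le by auto
  have t: "R ?s \<restriction>\<^sub>r t \<in> carrier C" "R ?s \<restriction>\<^sub>r t \<sqsubseteq> t" "D (R ?s \<restriction>\<^sub>r t) = R ?s"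
    using s st R_restr_le[of e s] e restr_le[of "R ?s" t] by auto
  show ?thesis
    using s t st e by (intro restr_eqI le_comp) auto
qed

section \<open>Product, domains and ranges of the constellation\<close>

lemma carrier_Q [simp]: "carrier Q = carrier C"
  by (simp add: to_constellation_def)

lemma mult_Q: "mult Q s t =
    (if s \<in> carrier C \<and> t \<in> carrier C \<and> R s \<sqsubseteq> D t then Some (s \<odot> (R s \<restriction>\<^sub>r t)) else None)"
  by (auto simp: to_constellation_def mult_comp)

lemma defined_Q: "defined Q s t \<longleftrightarrow> s \<in> carrier C \<and> t \<in> carrier C \<and> R s \<sqsubseteq> D t"
  by (simp add: defined_def mult_Q)

lemma right_identity_Q: "right_identity Q e \<longleftrightarrow> e \<in> carrier C \<and> D e = e"
proof
  assume e: "right_identity Q e"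
  then have c: "e \<in> carrier C" unfolding right_identity_def by simp
  then have "mult Q (D e) e = Some e" by (simp add: mult_Q le_refl)
  \<comment> \<open>Here \<open>e\<close> acts as a right identity on \<open>D e\<close>, so the
    same product also equals \<open>D e\<close>.\<close>
  moreover have "mult Q (D e) e = Some (D e)"
    using e c unfolding right_identity_def by (metis D_D D_closed R_D defined_Q le_refl)
  ultimately show "e \<in> carrier C \<and> D e = e" using c by simp
next
  assume e: "e \<in> carrier C \<and> D e = e"
  have "x \<odot> (R x \<restriction>\<^sub>r e) = x" if "x \<in> carrier C" "R x \<sqsubseteq> D e" for x
    using that e restr_identity[of "R x" e] by simp
  then show "right_identity Q e"
    using e unfolding right_identity_def by (auto simp: defined_Q mult_Q)
qed

text \<open>The product of \<open>e\<close> and \<open>x\<close> starts with \<open>e\<close>, so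
  its domain is \<open>e\<close>; if it equals \<open>x\<close>, then \<open>e\<close> is
  \<open>D x\<close>.\<close>

lemma left_unit_Q_iff:
  assumes "x \<in> carrier C"
  shows "right_identity Q e \<and> mult Q e x = Some x \<longleftrightarrow> e = D x"
proof
  assume *: "right_identity Q e \<and> mult Q e x = Some x"
  then have e: "e \<in> carrier C" "D e = e" and m: "mult Q e x = Some x"
    by (auto simp: right_identity_Q)
  have "R e = e" using e R_D by metis
  with m e have "e \<sqsubseteq> D x" "e \<odot> (e \<restriction>\<^sub>r x) = x" by (auto simp: mult_Q split: if_splits)
  then show "e = D x" using e assms \<open>R e = e\<close> D_comp[of e "e \<restriction>\<^sub>r x"] by simp
qed (use assms in \<open>simp add: right_identity_Q mult_Q le_refl\<close>)

lemma con_D_Q [simp]: "x \<in> carrier C \<Longrightarrow> con_D Q x = D x"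
  unfolding con_D_def by (rule the_equality) (auto simp: left_unit_Q_iff)

lemma con_Ds_Q: "con_Ds Q = cat_Ds C"
  unfolding con_Ds_def cat_Ds_def by simp

lemma D_mult_Q: "mult Q s t = Some u \<Longrightarrow> u \<in> carrier C \<and> D u = D s \<and> R u = R (R s \<restriction>\<^sub>r t)"
  by (auto simp: mult_Q split: if_splits)

lemma constellation_Q: "constellation Q"
  unfolding constellation_def
proof (intro conjI ballI)
  show "partial_magma Q"
    unfolding partial_magma_def by (auto simp: mult_Q split: if_splits)
next
  fix x y z
  assume c: "x \<in> carrier Q" "y \<in> carrier Q" "z \<in> carrier Q"
  show "mult_right Q x y z \<noteq> None \<longrightarrow> mult_left Q x y z = mult_right Q x y z"
  proof
    assume "mult_right Q x y z \<noteq> None"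
    then have le: "R y \<sqsubseteq> D z" "R x \<sqsubseteq> D y"
      using c by (auto simp: mult_right_def mult_Q split: if_splits)
    \<comment> \<open>Both bracketings expand to
      \<open>x \<odot> ?y \<odot> (R ?y \<restriction>\<^sub>r z)\<close>: the restriction of
      \<open>y \<odot> ?z\<close> splits by \<open>restr_comp\<close>, and the nested restriction of
      \<open>z\<close> collapses by \<open>restr_restr\<close>.\<close>
    let ?y = "R x \<restriction>\<^sub>r y" and ?z = "R y \<restriction>\<^sub>r z"
    have y: "?y \<in> carrier C" "D ?y = R x" "R ?y \<sqsubseteq> R y"
      using c le R_restr_le[of "R x" y] by auto
    have "R ?y \<sqsubseteq> D z" using y le le_trans by blast
    moreover have "R x \<restriction>\<^sub>r (y \<odot> ?z) = ?y \<odot> (R ?y \<restriction>\<^sub>r z)"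
      using c le y restr_comp[of "R x" y ?z] restr_restr[of "R ?y" "R y" z] by simp
    ultimately show "mult_left Q x y z = mult_right Q x y z"
      using c le y by (simp add: mult_right_def mult_left_def mult_Q comp_assoc)
  qed
next
  fix x y z
  assume c: "x \<in> carrier Q" "y \<in> carrier Q" "z \<in> carrier Q"
  show "defined Q x y \<and> defined Q y z \<longrightarrow> mult_right Q x y z \<noteq> None"
    using c by (auto simp: defined_Q mult_right_def mult_Q)
next
  fix x
  assume "x \<in> carrier Q"
  then show "\<exists>!e. right_identity Q e \<and> mult Q e x = Some x" by (simp add: left_unit_Q_iff)
qed

text \<open>For \<open>e\<close> in \<open>con_Ds Q\<close>, the product of \<open>s\<close> and
  \<open>e\<close> is defined iff \<open>R s \<sqsubseteq> e\<close>. So candidates are least among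
  the identities above \<open>R s\<close>, and antisymmetry leaves \<open>R s\<close>.\<close>

lemma range_candidates_Q:
  assumes s: "s \<in> carrier C"
  shows "range_candidates Q s = {R s}"
proof -
  have R: "e \<in> carrier C" "R e = e" "D e = e" if "e \<in> con_Ds Q" for e
    using that R_D by (auto simp: con_Ds_Q cat_Ds_iff, metis)
  have "R s \<in> range_candidates Q s"
    using s by (auto simp: range_candidates_def con_Ds_Q cat_Ds_iff defined_Q le_refl)
  moreover have "e = R s" if e: "e \<in> range_candidates Q s" for e
  proof (rule le_antisym)
    have "e \<in> con_Ds Q" using e unfolding range_candidates_def by blast
    note R = R[OF this]
    show "R s \<sqsubseteq> e" using e R by (simp add: range_candidates_def defined_Q)
    have "defined Q e (R s)"
      using e s calculation unfolding range_candidates_def by blast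
    then show "e \<sqsubseteq> R s" using s R by (simp add: defined_Q)
  qed
  ultimately show ?thesis by blast
qed

lemma con_R_Q [simp]: "s \<in> carrier C \<Longrightarrow> con_R Q s = R s"
  by (simp add: con_R_def range_candidates_Q)

text \<open>As \<open>R s\<close> is an identity, only the restriction of \<open>t\<close> survives.
  This serves both the range law and left cancellation.\<close>

lemma mult_R_Q: "s \<in> carrier C \<Longrightarrow> t \<in> carrier C \<Longrightarrow> R s \<sqsubseteq> D t \<Longrightarrow> mult Q (R s) t = Some (R s \<restriction>\<^sub>r t)"
  using D_left[of "R s \<restriction>\<^sub>r t"] by (simp add: mult_Q)

lemma constellation_with_range_Q: "constellation_with_range Q"
  unfolding constellation_with_range_def
proof (intro conjI ballI allI impI constellation_Q)
  fix s
  assume "s \<in> carrier Q"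
  then show "\<exists>!e. e \<in> range_candidates Q s" by (simp add: range_candidates_Q)
next
  fix s t u
  assume m: "mult Q s t = Some u"
  then have st: "s \<in> carrier C" "t \<in> carrier C" "R s \<sqsubseteq> D t"
    by (auto simp: mult_Q split: if_splits)
  with D_mult_Q[OF m] show "\<exists>v. mult Q (con_R Q s) t = Some v \<and> con_R Q v = con_R Q u"
    by (simp add: mult_R_Q)
qed

text \<open>Equal products mean that \<open>a\<close> followed by the restrictions of
  \<open>b\<close> and \<open>c\<close> to \<open>R a\<close> gives the same element; the
  epimorphism \<open>a\<close> cancels.\<close>

lemma left_cancellative_Q:
  assumes "left_cancellative_category C"
  shows "left_cancellative_constellation Q"
  unfolding left_cancellative_constellation_def
proof (intro conjI allI impI constellation_with_range_Q)
  fix a b c u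
  assume "mult Q a b = Some u \<and> mult Q a c = Some u"
  then have abc: "a \<in> carrier C" "b \<in> carrier C" "c \<in> carrier C" "R a \<sqsubseteq> D b" "R a \<sqsubseteq> D c"
    and "a \<odot> (R a \<restriction>\<^sub>r b) = u" "a \<odot> (R a \<restriction>\<^sub>r c) = u"
    by (auto simp: mult_Q split: if_splits)
  then have "mult C a (R a \<restriction>\<^sub>r b) = Some u" "mult C a (R a \<restriction>\<^sub>r c) = Some u"
    by (auto simp: mult_conv)
  then have "R a \<restriction>\<^sub>r b = R a \<restriction>\<^sub>r c"
    using assms abc unfolding left_cancellative_category_def epimorphism_def by blast
  then show "\<exists>v. mult Q (con_R Q a) b = Some v \<and> mult Q (con_R Q a) c = Some v"
    using abc by (simp add: mult_R_Q)
qed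

end

section \<open>IS-categories\<close>

locale IS_cat = cat C for C :: "'a partial_magma" +
  fixes I S :: "'a set"
  assumes IS: "IS_category C I S"
begin

abbreviation \<rho> :: "'a \<Rightarrow> 'a" where "\<rho> \<equiv> surjection_part C I S"

lemma sub_I: "subcategory C I" and sub_S: "subcategory C S"
  using IS unfolding IS_category_def by blast+

lemma I_carrier [simp]: "i \<in> I \<Longrightarrow> i \<in> carrier C"
  and S_carrier [simp]: "s \<in> S \<Longrightarrow> s \<in> carrier C"
  using sub_I sub_S unfolding subcategory_def by blast+

lemma comp_I [simp]: "i \<in> I \<Longrightarrow> j \<in> I \<Longrightarrow> R i = D j \<Longrightarrow> i \<odot> j \<in> I"
  using sub_I mult_comp[of i j] unfolding subcategory_def by blast

lemma comp_S [simp]: "s \<in> S \<Longrightarrow> t \<in> S \<Longrightarrow> R s = D t \<Longrightarrow> s \<odot> t \<in> S"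
  using sub_S mult_comp[of s t] unfolding subcategory_def by blast

lemma D_mem [simp]: "x \<in> carrier C \<Longrightarrow> D x \<in> I" "x \<in> carrier C \<Longrightarrow> D x \<in> S"
  using IS unfolding IS_category_def cat_Ds_def by blast+

lemma R_mem [simp]: "x \<in> carrier C \<Longrightarrow> R x \<in> I" "x \<in> carrier C \<Longrightarrow> R x \<in> S"
  using D_mem[of "R x"] by auto

text \<open>The second alternative matters: insertions running in opposite directions between the
  same identities are equal too, which is the source of antisymmetry of the I-order.\<close>

lemma insertion_unique:
  assumes "i \<in> I" "j \<in> I" "D i = D j \<and> R i = R j \<or> D i = R j \<and> R i = D j"
  shows "i = j"
proof -
  have "D i \<in> cat_Ds C" "R i \<in> cat_Ds C" using assms by (auto simp: cat_Ds_iff)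
  moreover have "\<forall>e\<in>cat_Ds C. \<forall>f\<in>cat_Ds C. \<forall>i\<in>I. \<forall>j\<in>I.
        (D i = e \<and> R i = f \<or> D i = f \<and> R i = e) \<and> (D j = e \<and> R j = f \<or> D j = f \<and> R j = e) \<longrightarrow> i = j"
    using IS unfolding IS_category_def by (elim conjE)
  ultimately show ?thesis using assms by metis
qed

text \<open>The identity \<open>D i\<close> is itself an insertion with the same endpoints.\<close>

lemma insertion_loop:
  assumes "i \<in> I" "D i = R i"
  shows "i = D i"
  using assms by (intro insertion_unique) auto

section \<open>Factorization into a surjection and an insertion\<close>

lemma factorization_ex1:
  "a \<in> carrier C \<Longrightarrow> \<exists>!(s, i). s \<in> S \<and> i \<in> I \<and> mult C s i = Some a"
  using IS unfolding IS_category_def by blast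

text \<open>Factorizations are unique, so \<open>\<rho>\<close> is computed by exhibiting any
  product of a surjection and an insertion.\<close>

lemma surjection_part_comp [simp]:
  assumes "s \<in> S" "i \<in> I" "R s = D i"
  shows "\<rho> (s \<odot> i) = s"
proof -
  have "s \<odot> i \<in> carrier C" using assms by simp
  moreover have "case (s, i) of (s', i') \<Rightarrow> s' \<in> S \<and> i' \<in> I \<and> mult C s' i' = Some (s \<odot> i)"
    using assms by (simp add: mult_comp)
  ultimately show ?thesis
    unfolding surjection_part_def by (simp only: the1_equality[OF factorization_ex1] fst_conv)
qed

lemma factorization:
  assumes "a \<in> carrier C"
  obtains i where "i \<in> I" "\<rho> a \<in> S" "D i = R (\<rho> a)" "R i = R a" "D (\<rho> a) = D a" "\<rho> a \<odot> i = a"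
proof -
  obtain s i where si: "s \<in> S" "i \<in> I" "mult C s i = Some a"
    using factorization_ex1[OF assms] by auto
  then have "R s = D i" "a = s \<odot> i" by (auto simp: mult_eq_Some_iff)
  with si show thesis by (intro that[of i]) simp_all
qed

lemma surjection_part_mem [simp]: "a \<in> carrier C \<Longrightarrow> \<rho> a \<in> S"
  and D_surjection_part [simp]: "a \<in> carrier C \<Longrightarrow> D (\<rho> a) = D a"
  by (erule factorization, assumption)+

lemma surjection_part_S [simp]: "s \<in> S \<Longrightarrow> \<rho> s = s"
  using surjection_part_comp[of s "R s"] by simp

lemma surjection_part_I [simp]: "i \<in> I \<Longrightarrow> \<rho> i = D i"
  using surjection_part_comp[of "D i" i] by simp

section \<open>The I-order on the whole category\<close>

lemma I_orderI:
  assumes "s \<in> carrier C" "t \<in> carrier C" "i \<in> I" "j \<in> I"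
    "D i = R s" "R j = D t" "s \<odot> i = j \<odot> t"
  shows "(s, t) \<in> I_order C I"
proof -
  have "mult C s i = Some (s \<odot> i)" "mult C j t = Some (s \<odot> i)"
    using assms by (simp_all add: mult_comp)
  then show ?thesis using assms unfolding I_order_def by blast
qed

text \<open>Read \<open>s \<odot> i = j \<odot> t\<close> as a commuting square: the domain and
  codomain of the common value fix the remaining endpoints of \<open>i\<close> and
  \<open>j\<close>.\<close>

lemma I_orderE:
  assumes "(s, t) \<in> I_order C I"
  obtains i j where "s \<in> carrier C" "t \<in> carrier C" "i \<in> I" "j \<in> I"
    "D i = R s" "R i = R t" "D j = D s" "R j = D t" "s \<odot> i = j \<odot> t"
proof -
  obtain i j u where *: "i \<in> I" "j \<in> I" "mult C s i = Some u" "mult C j t = Some u"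
    using assms unfolding I_order_def by blast
  then have eq: "R s = D i" "R j = D t" "s \<odot> i = j \<odot> t" and st: "s \<in> carrier C" "t \<in> carrier C"
    by (auto simp: mult_eq_Some_iff)
  have "D j = D s" "R i = R t"
    using D_comp[of s i] D_comp[of j t] R_comp[of s i] R_comp[of j t] * eq st by simp_all
  with * eq st show thesis using that[of i j] by simp
qed

text \<open>Between identities the square collapses to one insertion:
  \<open>e \<odot> i = i = i \<odot> f\<close>.\<close>

lemma I_order_identity_iff:
  assumes "e \<in> carrier C" "D e = e" "f \<in> carrier C" "D f = f"
  shows "(e, f) \<in> I_order C I \<longleftrightarrow> (\<exists>i\<in>I. D i = e \<and> R i = f)"
proof
  assume "\<exists>i\<in>I. D i = e \<and> R i = f"
  then obtain i where i: "i \<in> I" "D i = e" "R i = f" by blast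
  have "R e = e" "R f = f" using assms R_D by metis+
  then show "(e, f) \<in> I_order C I"
    using i assms D_left[of i] R_right[of i] by (intro I_orderI[of e f i i]) auto
next
  assume "(e, f) \<in> I_order C I"
  then show "\<exists>i\<in>I. D i = e \<and> R i = f" by (rule I_orderE) (use assms in metis)
qed

text \<open>The insertions of the two squares run in opposite directions between the same
  identities, so they are equal in pairs and hence loops. Loops are identities, and the square then
  reads \<open>s = t\<close>.\<close>

lemma I_order_antisym:
  assumes "(s, t) \<in> I_order C I" "(t, s) \<in> I_order C I"
  shows "s = t"
proof -
  obtain i j where st: "s \<in> carrier C" "t \<in> carrier C" "i \<in> I" "j \<in> I"
    "D i = R s" "R i = R t" "D j = D s" "R j = D t" "s \<odot> i = j \<odot> t"
    using assms(1) by (rule I_orderE)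
  obtain k l where ts: "k \<in> I" "l \<in> I" "D k = R t" "R k = R s" "D l = D t" "R l = D s"
    using assms(2) by (rule I_orderE)
  have "i = k" "j = l" using st ts by (auto intro: insertion_unique)
  then have "i = D i" "j = D j" using st ts insertion_loop by metis+
  then have "i = R s" "j = D t" using st ts \<open>j = l\<close> by metis+
  then show "s = t" using st by (metis D_left R_right)
qed

text \<open>The two squares are pasted along \<open>t\<close>, composing the insertions on each
  side.\<close>

lemma I_order_trans:
  assumes "(s, t) \<in> I_order C I" "(t, u) \<in> I_order C I"
  shows "(s, u) \<in> I_order C I"
proof -
  obtain i j where st: "s \<in> carrier C" "t \<in> carrier C" "i \<in> I" "j \<in> I"
    "D i = R s" "R i = R t" "D j = D s" "R j = D t" "s \<odot> i = j \<odot> t"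
    using assms(1) by (rule I_orderE)
  obtain k l where tu: "u \<in> carrier C" "k \<in> I" "l \<in> I"
    "D k = R t" "R k = R u" "D l = D t" "R l = D u" "t \<odot> k = l \<odot> u"
    using assms(2) by (rule I_orderE)
  have "s \<odot> (i \<odot> k) = (s \<odot> i) \<odot> k" using st tu by (subst comp_assoc) auto
  also have "\<dots> = (j \<odot> t) \<odot> k" using st by simp
  also have "\<dots> = j \<odot> (t \<odot> k)" using st tu by (simp add: comp_assoc)
  also have "\<dots> = j \<odot> l \<odot> u" using st tu by (simp add: comp_assoc)
  finally have "s \<odot> (i \<odot> k) = j \<odot> l \<odot> u" .
  moreover have "i \<odot> k \<in> I" "j \<odot> l \<in> I" "D (i \<odot> k) = R s" "R (j \<odot> l) = D u"
    using st tu by auto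
  ultimately show ?thesis using st tu I_orderI by blast
qed

text \<open>The insertions \<open>i\<close> and \<open>l\<close> both run from \<open>R a\<close> to
  \<open>R b\<close>, so they are equal and the two squares can be pasted along this common
  edge.\<close>

lemma I_order_comp:
  assumes "(a, b) \<in> I_order C I" "(c, d) \<in> I_order C I" "R a = D c" "R b = D d"
  shows "(a \<odot> c, b \<odot> d) \<in> I_order C I"
proof -
  obtain i j where ab: "a \<in> carrier C" "b \<in> carrier C" "i \<in> I" "j \<in> I"
    "D i = R a" "R i = R b" "D j = D a" "R j = D b" "a \<odot> i = j \<odot> b"
    using assms(1) by (rule I_orderE)
  obtain k l where cd: "c \<in> carrier C" "d \<in> carrier C" "k \<in> I" "l \<in> I"
    "D k = R c" "R k = R d" "D l = D c" "R l = D d" "c \<odot> k = l \<odot> d"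
    using assms(2) by (rule I_orderE)
  have "l = i" using ab cd assms(3,4) by (intro insertion_unique) auto
  have "a \<odot> c \<odot> k = a \<odot> (i \<odot> d)" using ab cd assms(3,4) \<open>l = i\<close> by (simp add: comp_assoc)
  also have "\<dots> = (a \<odot> i) \<odot> d" using ab cd assms(3,4) by (subst comp_assoc) auto
  also have "\<dots> = j \<odot> (b \<odot> d)" using ab cd assms(3,4) by (simp add: comp_assoc)
  finally show ?thesis
    using ab cd assms(3,4) by (intro I_orderI[of "a \<odot> c" "b \<odot> d" k j]) auto
qed

text \<open>In the square for \<open>(a, b)\<close> one insertion joins the domains and the other
  joins the codomains.\<close>

lemma I_order_D: "(a, b) \<in> I_order C I \<Longrightarrow> (D a, D b) \<in> I_order C I"
  and I_order_R: "(a, b) \<in> I_order C I \<Longrightarrow> (R a, R b) \<in> I_order C I"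
  by (auto elim!: I_orderE simp: I_order_identity_iff)

lemma ordered_category_I_order: "ordered_category C (I_order C I)"
  unfolding ordered_category_def
proof (intro conjI allI impI)
  have "refl_on (carrier C) (I_order C I)"
    by (rule refl_onI, rule_tac i = "R x" and j = "D x" in I_orderI) auto
  moreover have "I_order C I \<subseteq> carrier C \<times> carrier C" by (auto simp: I_order_def)
  ultimately show "partial_order_on (carrier C) (I_order C I)"
    unfolding partial_order_on_def preorder_on_def trans_def antisym_def
    using I_order_antisym I_order_trans by blast
qed (auto simp: category mult_eq_Some_iff intro: I_order_comp I_order_D I_order_R)

section \<open>The surjections as an ordered category with restrictions\<close>

abbreviation K where "K \<equiv> surjection_category C S"
abbreviation Q where "Q \<equiv> surjection_constellation C I S"
abbreviation r where "r \<equiv> surjection_order C I S"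

lemma category_K: "category K"
  and D_K [simp]: "s \<in> S \<Longrightarrow> cat_D K s = D s" and R_K [simp]: "s \<in> S \<Longrightarrow> cat_R K s = R s"
  unfolding surjection_category_def using subcategory_cat[OF sub_S] by auto

lemma carrier_K [simp]: "carrier K = S"
  by (simp add: surjection_category_def restrict_to_def)

lemma mult_K: "mult K s t = (if s \<in> S \<and> t \<in> S \<and> R s = D t then Some (s \<odot> t) else None)"
  by (auto simp: surjection_category_def restrict_to_def mult_conv)

lemma r_iff: "(s, t) \<in> r \<longleftrightarrow> s \<in> S \<and> t \<in> S \<and> (s, t) \<in> I_order C I"
  unfolding surjection_order_def by blast

lemma cat_Ds_K: "cat_Ds K = cat_Ds C"
proof -
  interpret K: cat K by unfold_locales (rule category_K)
  have "e \<in> S" if "e \<in> cat_Ds C" for e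
    using that IS unfolding IS_category_def by blast
  then show ?thesis by (auto simp: K.cat_Ds_iff cat_Ds_iff)
qed

lemma ordered_category_K: "ordered_category K r"
  unfolding ordered_category_def
proof (intro conjI allI impI category_K)
  have "partial_order_on (carrier C) (I_order C I)"
    using ordered_category_I_order unfolding ordered_category_def by blast
  note po = partial_order_onD[OF this]
  have "refl_on S r" by (rule refl_onI) (auto simp: r_iff intro: refl_onD[OF po(1)])
  moreover have "r \<subseteq> S \<times> S" by (auto simp: r_iff)
  moreover have "trans r" by (rule transI) (auto simp: r_iff intro: I_order_trans)
  moreover have "antisym r" by (rule antisymI) (auto simp: r_iff intro: I_order_antisym)
  ultimately show "partial_order_on (carrier K) r"
    unfolding partial_order_on_def preorder_on_def by simp
qed (auto simp: mult_K r_iff split: if_splits intro: I_order_comp I_order_D I_order_R)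

text \<open>Gives existence and uniqueness of restrictions at once. The factorization of
  \<open>i \<odot> s\<close> is a square putting \<open>\<rho> (i \<odot> s)\<close> below
  \<open>s\<close>. Conversely, the square of any such \<open>x\<close> must use the insertion
  \<open>i\<close>, so \<open>x\<close> is the surjection part of
  \<open>i \<odot> s\<close>.\<close>

lemma restriction_witness_iff:
  assumes "i \<in> I" "s \<in> S" "R i = D s"
  shows "(x, s) \<in> r \<and> cat_D K x = D i \<longleftrightarrow> x = \<rho> (i \<odot> s)"
proof
  have c: "i \<odot> s \<in> carrier C" "D (i \<odot> s) = D i" using assms by auto
  from c(1) obtain k where k: "k \<in> I" "\<rho> (i \<odot> s) \<in> S" "D k = R (\<rho> (i \<odot> s))"
    "D (\<rho> (i \<odot> s)) = D (i \<odot> s)" "\<rho> (i \<odot> s) \<odot> k = i \<odot> s"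
    by (rule factorization)
  then have "(\<rho> (i \<odot> s), s) \<in> I_order C I"
    using assms by (intro I_orderI[of _ s k i]) auto
  then show "x = \<rho> (i \<odot> s) \<Longrightarrow> (x, s) \<in> r \<and> cat_D K x = D i"
    using k(2,4) c assms by (simp add: r_iff)
next
  assume *: "(x, s) \<in> r \<and> cat_D K x = D i"
  then have x: "x \<in> S" "(x, s) \<in> I_order C I" "D x = D i" by (auto simp: r_iff)
  from x(2) obtain k j where kj: "k \<in> I" "j \<in> I" "D k = R x" "D j = D x" "R j = D s" "x \<odot> k = j \<odot> s"
    by (rule I_orderE)
  then have "j = i" using x assms by (intro insertion_unique) auto
  with kj(6) have "i \<odot> s = x \<odot> k" by simp
  then show "x = \<rho> (i \<odot> s)" using x(1) kj(1,3) surjection_part_comp[of x k] by metis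
qed

lemma ordered_category_with_restrictions_K: "ordered_category_with_restrictions K r"
  unfolding ordered_category_with_restrictions_def
proof (intro conjI ballI impI ordered_category_K)
  fix s e
  assume s: "s \<in> carrier K" and e: "e \<in> cat_Ds K" and le: "(e, cat_D K s) \<in> r"
  then have "\<exists>i\<in>I. D i = e \<and> R i = D s"
    by (subst I_order_identity_iff[symmetric]) (auto simp: r_iff cat_Ds_K cat_Ds_iff)
  then obtain i where "i \<in> I" "D i = e" "R i = D s" by blast
  then show "\<exists>!x. (x, s) \<in> r \<and> cat_D K x = e"
    using restriction_witness_iff[of i s] s by simp
qed

lemma left_cancellative_K:
  assumes "IS_regular C S"
  shows "left_cancellative_category K"
  unfolding left_cancellative_category_def epimorphism_def
proof (intro conjI ballI allI impI category_K)
  fix s x y z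
  assume "mult K s x = Some z \<and> mult K s y = Some z"
  then have "s \<in> S" "mult C s x = Some z" "mult C s y = Some z"
    by (auto simp: mult_K mult_eq_Some_iff split: if_splits)
  then show "x = y" using assms unfolding IS_regular_def epimorphism_def by blast
qed

lemma ordered_cat_restr_K: "ordered_cat_restr K r"
  using category_K ordered_category_with_restrictions_K
  by (simp add: ordered_cat_restr_def ordered_cat_restr_axioms_def cat_def)

text \<open>Specializes the general facts on ordered categories with restrictions to
  \<open>K\<close>, with domains and codomains expressed in \<open>C\<close>.\<close>

lemma
  shows constellation_with_range_Q: "constellation_with_range Q"
    and con_D_Q [simp]: "s \<in> S \<Longrightarrow> con_D Q s = D s"
    and con_R_Q [simp]: "s \<in> S \<Longrightarrow> con_R Q s = R s"
    and left_cancellative_Q: "IS_regular C S \<Longrightarrow> left_cancellative_constellation Q"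
    and con_Ds_Q: "con_Ds Q = cat_Ds C"
proof -
  interpret K: ordered_cat_restr K r by (rule ordered_cat_restr_K)
  note Q = surjection_constellation_def
  show "constellation_with_range Q" unfolding Q by (rule K.constellation_with_range_Q)
  show "s \<in> S \<Longrightarrow> con_D Q s = D s" "s \<in> S \<Longrightarrow> con_R Q s = R s"
    unfolding Q by simp_all
  show "IS_regular C S \<Longrightarrow> left_cancellative_constellation Q"
    unfolding Q by (intro K.left_cancellative_Q left_cancellative_K)
  show "con_Ds Q = cat_Ds C" unfolding Q by (simp add: K.con_Ds_Q cat_Ds_K)
qed

section \<open>Products of surjection parts\<close>

lemma carrier_Q [simp]: "carrier Q = S"
  by (simp add: surjection_constellation_def to_constellation_def)

lemma le_iff_insertion:
  assumes "s \<in> S" "t \<in> S"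
  shows "(R s, D t) \<in> r \<longleftrightarrow> (\<exists>i\<in>I. D i = R s \<and> R i = D t)"
  using assms by (subst I_order_identity_iff[symmetric]) (auto simp: r_iff)

text \<open>With \<open>i\<close> the insertion part of \<open>a\<close>, the product
  \<open>(s \<odot> \<rho> a) \<odot> i\<close> is already a factorization of
  \<open>s \<odot> a\<close>.\<close>

lemma surjection_part_left:
  assumes "s \<in> S" "a \<in> carrier C" "R s = D a"
  shows "\<rho> (s \<odot> a) = s \<odot> \<rho> a"
proof -
  from assms(2) obtain i where i: "i \<in> I" "\<rho> a \<in> S" "D i = R (\<rho> a)" "D (\<rho> a) = D a" "\<rho> a \<odot> i = a"
    by (rule factorization)
  have "s \<odot> a = (s \<odot> \<rho> a) \<odot> i" using assms i by (subst comp_assoc) auto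
  then show ?thesis using assms i by simp
qed

text \<open>If \<open>k\<close> is the insertion part of \<open>a \<odot> \<rho> b\<close> and
  \<open>j\<close> that of \<open>b\<close>, then \<open>a \<odot> b\<close> has the same surjection
  part as \<open>a \<odot> \<rho> b\<close>, with insertion part \<open>k \<odot> j\<close>.\<close>

lemma surjection_part_right:
  assumes "a \<in> carrier C" "b \<in> carrier C" "R a = D b"
  shows "\<rho> (a \<odot> \<rho> b) = \<rho> (a \<odot> b)"
proof -
  from assms(2) obtain j where j: "j \<in> I" "\<rho> b \<in> S" "D j = R (\<rho> b)" "D (\<rho> b) = D b" "\<rho> b \<odot> j = b"
    by (rule factorization)
  let ?c = "a \<odot> \<rho> b"
  have c: "?c \<in> carrier C" "R ?c = R (\<rho> b)" using assms j by auto
  from c(1) obtain k where k: "k \<in> I" "\<rho> ?c \<in> S" "D k = R (\<rho> ?c)" "R k = R ?c" "\<rho> ?c \<odot> k = ?c"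
    by (rule factorization)
  have "a \<odot> b = a \<odot> (\<rho> b \<odot> j)" using j by simp
  also have "\<dots> = ?c \<odot> j" using assms j by (subst comp_assoc) auto
  also have "\<dots> = (\<rho> ?c \<odot> k) \<odot> j" using k by simp
  also have "\<dots> = \<rho> ?c \<odot> (k \<odot> j)" using assms j k c by (subst comp_assoc) auto
  finally show ?thesis using j k c by simp
qed

text \<open>The insertion \<open>i\<close> identifies the restriction of \<open>t\<close> to
  \<open>R s\<close> as \<open>\<rho> (i \<odot> t)\<close>; then \<open>s\<close> moves inside
  \<open>\<rho>\<close> by \<open>surjection_part_left\<close>.\<close>

lemma mult_Q_insertion:
  assumes "s \<in> S" "t \<in> S" "i \<in> I" "D i = R s" "R i = D t"
  shows "mult Q s t = Some (\<rho> (s \<odot> (i \<odot> t)))"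
proof -
  have le: "(R s, D t) \<in> r" using assms le_iff_insertion by blast
  have "restriction K r (R s) t = \<rho> (i \<odot> t)"
    using restriction_witness_iff[of i t] assms unfolding restriction_def by simp
  then show ?thesis
    using assms le surjection_part_left[of s "i \<odot> t"]
    by (simp add: surjection_constellation_def to_constellation_def mult_K)
qed

lemma defined_Q_iff: "defined Q s t \<longleftrightarrow> s \<in> S \<and> t \<in> S \<and> (\<exists>i\<in>I. D i = R s \<and> R i = D t)"
proof
  assume "defined Q s t"
  then have "s \<in> S" "t \<in> S" "(R s, D t) \<in> r"
    by (auto simp: defined_def surjection_constellation_def to_constellation_def split: if_splits)
  then show "s \<in> S \<and> t \<in> S \<and> (\<exists>i\<in>I. D i = R s \<and> R i = D t)" using le_iff_insertion by blast
qed (auto simp: defined_def mult_Q_insertion)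

text \<open>The insertion part of \<open>a\<close> ends at \<open>R a = D b\<close>, the domain of
  \<open>\<rho> b\<close>. So it is the insertion connecting \<open>\<rho> a\<close> with
  \<open>\<rho> b\<close>, and it turns \<open>\<rho> a\<close> back into \<open>a\<close>.\<close>

lemma mult_Q_surjection_part:
  assumes "a \<in> carrier C" "b \<in> carrier C" "R a = D b"
  shows "mult Q (\<rho> a) (\<rho> b) = Some (\<rho> (a \<odot> b))"
proof -
  from assms(1) obtain i where i: "i \<in> I" "\<rho> a \<in> S" "D i = R (\<rho> a)" "R i = R a" "\<rho> a \<odot> i = a"
    by (rule factorization)
  have "\<rho> a \<odot> (i \<odot> \<rho> b) = (\<rho> a \<odot> i) \<odot> \<rho> b" using assms i by (subst comp_assoc) auto
  then show ?thesis
    using assms i mult_Q_insertion[of "\<rho> a" "\<rho> b" i] surjection_part_right[of a b] by simp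
qed

text \<open>The two insertion parts have the same endpoints, so they agree as well.\<close>

lemma surjection_part_inj:
  assumes "a \<in> carrier C" "b \<in> carrier C" "\<rho> a = \<rho> b" "R a = R b"
  shows "a = b"
proof -
  from assms(1) obtain i where i: "i \<in> I" "D i = R (\<rho> a)" "R i = R a" "\<rho> a \<odot> i = a"
    by (rule factorization)
  from assms(2) obtain j where j: "j \<in> I" "D j = R (\<rho> b)" "R j = R b" "\<rho> b \<odot> j = b"
    by (rule factorization)
  have "i = j" using assms i j by (intro insertion_unique) auto
  then show ?thesis using assms i j by metis
qed

lemma canonical_radiant_surjection_part: "canonical_radiant C Q \<rho>"
  unfolding canonical_radiant_def full_radiant_def radiant_def
proof (intro conjI ballI allI impI category constellation)
  show "constellation Q"
    using constellation_with_range_Q unfolding constellation_with_range_def by blast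
  show "\<rho> ` carrier C \<subseteq> carrier Q" by auto
  show "\<rho> ` carrier C = carrier Q"
  proof
    show "carrier Q \<subseteq> \<rho> ` carrier C"
      using image_eqI[of _ \<rho>] by (metis S_carrier carrier_Q subsetI surjection_part_S)
  qed auto
next
  fix s
  assume s: "s \<in> carrier C"
  then show "con_D Q (\<rho> s) = \<rho> (con_D C s)" by (simp add: con_D_eq)
next
  fix s t u
  assume "mult C s t = Some u"
  then show "mult Q (\<rho> s) (\<rho> t) = Some (\<rho> u)"
    by (simp add: mult_eq_Some_iff mult_Q_surjection_part)
next
  fix s t u
  assume st: "s \<in> carrier C" "t \<in> carrier C" and m: "mult Q (\<rho> s) (\<rho> t) = Some u"
  then have "defined Q (\<rho> s) (\<rho> t)" by (simp add: defined_def)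
  then obtain i where i: "i \<in> I" "D i = R (\<rho> s)" "R i = D t"
    using st by (auto simp: defined_Q_iff)
  \<comment> \<open>For fullness, keep \<open>t\<close> and replace \<open>s\<close> by
    \<open>\<rho> s\<close> followed by the connecting insertion: the surjection part stays the same
    and the codomain becomes \<open>D t\<close>.\<close>
  then have "defined C (\<rho> s \<odot> i) t" "\<rho> s = \<rho> (\<rho> s \<odot> i)" "\<rho> s \<odot> i \<in> carrier C"
    using st by (simp_all add: defined_def mult_conv)
  with st show "\<exists>s'\<in>carrier C. \<exists>t'\<in>carrier C. \<rho> s = \<rho> s' \<and> \<rho> t = \<rho> t' \<and> defined C s' t'"
    by blast
next
  fix a b
  assume "a \<in> carrier C" "b \<in> carrier C" "\<rho> a = \<rho> b"
  then show "D a = D b" by (metis D_surjection_part)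
next
  fix a b
  assume "a \<in> carrier C" "b \<in> carrier C" "\<rho> a = \<rho> b \<and> R a = R b"
  then show "a = b" using surjection_part_inj by blast
qed

section \<open>The isomorphism onto the canonical extension\<close>

definition \<psi> :: "'a \<Rightarrow> 'a \<times> 'a" where "\<psi> a = (\<rho> a, R a)"

text \<open>Such a pair is the data of a factorization: a surjection and the target of an insertion
  out of its codomain, which is determined by that target.\<close>

lemma carrier_extension:
  "carrier (canonical_extension Q) =
    {(s, e). s \<in> S \<and> e \<in> carrier C \<and> D e = e \<and> (\<exists>i\<in>I. D i = R s \<and> R i = e)}"
proof -
  have "e \<in> S" if "e \<in> carrier C" "D e = e" for e using that D_mem(2) by metis
  then show ?thesis
    by (auto simp: canonical_extension_def restrict_to_def con_Ds_Q cat_Ds_iff defined_Q_iff)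
qed

lemma \<psi>_bij: "bij_betw \<psi> (carrier C) (carrier (canonical_extension Q))"
proof (rule bij_betwI')
  fix a b
  assume "a \<in> carrier C" "b \<in> carrier C"
  then show "\<psi> a = \<psi> b \<longleftrightarrow> a = b" using surjection_part_inj by (auto simp: \<psi>_def)
next
  fix a
  assume a: "a \<in> carrier C"
  then obtain i where "i \<in> I" "D i = R (\<rho> a)" "R i = R a" by (rule factorization)
  with a show "\<psi> a \<in> carrier (canonical_extension Q)" by (auto simp: \<psi>_def carrier_extension)
next
  fix p
  assume "p \<in> carrier (canonical_extension Q)"
  then obtain s i where "p = (s, R i)" "s \<in> S" "i \<in> I" "D i = R s"
    by (auto simp: carrier_extension)
  \<comment> \<open>The preimage of a pair is its surjection followed by the insertion to its second
    component.\<close>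
  then show "\<exists>a\<in>carrier C. p = \<psi> a" by (intro bexI[of _ "s \<odot> i"]) (auto simp: \<psi>_def)
qed

text \<open>The matching condition in the extension compares \<open>R a\<close> with the domain of
  \<open>\<rho> b\<close>, which is \<open>D b\<close>; so both products are defined under the same
  condition.\<close>

lemma mult_extension_\<psi>:
  assumes "a \<in> carrier C" "b \<in> carrier C"
  shows "mult (canonical_extension Q) (\<psi> a) (\<psi> b) = map_option \<psi> (mult C a b)"
proof -
  have "mult (canonical_extension Q) (\<psi> a) (\<psi> b) =
      (if R a = D b then map_option (\<lambda>u. (u, R b)) (mult Q (\<rho> a) (\<rho> b)) else None)"
    using \<psi>_bij assms
    by (auto simp: \<psi>_def canonical_extension_def restrict_to_def bij_betw_def)
  then show ?thesis using assms by (simp add: mult_conv mult_Q_surjection_part) (simp add: \<psi>_def)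
qed

lemma category_iso_\<psi>: "category_iso C (canonical_extension Q) \<psi>"
proof (intro category_transport category \<psi>_bij mult_extension_\<psi>)
  show "partial_magma (canonical_extension Q)"
    unfolding partial_magma_def
  proof (intro allI impI)
    fix x y z
    assume m: "mult (canonical_extension Q) x y = Some z"
    then have xy: "x \<in> carrier (canonical_extension Q)" "y \<in> carrier (canonical_extension Q)"
      by (auto simp: canonical_extension_def restrict_to_def split: if_splits)
    then obtain a b where "a \<in> carrier C" "b \<in> carrier C" "x = \<psi> a" "y = \<psi> b"
      using \<psi>_bij unfolding bij_betw_def by (metis imageE)
    \<comment> \<open>Both factors are images under \<open>\<psi>\<close>, so the product is the
      image of a composite and stays in the carrier.\<close>
    with m have "z \<in> \<psi> ` carrier C" by (auto simp: mult_extension_\<psi> mult_eq_Some_iff)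
    then have "z \<in> carrier (canonical_extension Q)" using \<psi>_bij unfolding bij_betw_def by blast
    with xy show "x \<in> carrier (canonical_extension Q) \<and> y \<in> carrier (canonical_extension Q) \<and>
        z \<in> carrier (canonical_extension Q)" by blast
  qed
qed

lemma \<psi>_S: "\<psi> ` S = extension_S Q"
  by (auto simp: \<psi>_def extension_S_def image_iff)

text \<open>Since \<open>\<rho> i = D i\<close>, an insertion is sent to its pair of endpoints; and
  the product of two identities exists in \<open>Q\<close> iff an insertion joins them.\<close>

lemma \<psi>_I: "\<psi> ` I = extension_I Q"
proof -
  have "extension_I Q = {(D i, R i) | i. i \<in> I}"
  proof (intro set_eqI iffI)
    fix p
    assume "p \<in> extension_I Q"
    then obtain e f i where "p = (e, f)" "e \<in> carrier C" "D e = e" "f = D f" "i \<in> I" "D i = R e" "R i = D f"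
      by (auto simp: extension_I_def con_Ds_Q cat_Ds_iff defined_Q_iff)
    moreover from this have "R e = e" by (metis R_D)
    ultimately show "p \<in> {(D i, R i) | i. i \<in> I}" by (intro CollectI exI[of _ i]) simp
  qed (auto simp: extension_I_def con_Ds_Q cat_Ds_iff defined_Q_iff)
  then show ?thesis by (auto simp: \<psi>_def image_iff)
qed

end

theorem theorem9p1:
  fixes C :: "'a partial_magma" and I S :: "'a set"
  assumes "IS_category C I S"
  shows "ordered_category C (I_order C I)
    \<and> (ordered_category_with_restrictions (surjection_category C S) (surjection_order C I S)
        \<and> (IS_regular C S \<longrightarrow> left_cancellative_category (surjection_category C S)))
    \<and> (constellation_with_range (surjection_constellation C I S)
        \<and> (\<forall>s\<in>S. con_D (surjection_constellation C I S) s = cat_D C s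
              \<and> con_R (surjection_constellation C I S) s = cat_R C s)
        \<and> (IS_regular C S \<longrightarrow> left_cancellative_constellation (surjection_constellation C I S))
        \<and> canonical_radiant C (surjection_constellation C I S) (surjection_part C I S))
    \<and> (\<exists>\<psi>. category_iso C (canonical_extension (surjection_constellation C I S)) \<psi>
        \<and> \<psi> ` S = extension_S (surjection_constellation C I S)
        \<and> \<psi> ` I = extension_I (surjection_constellation C I S))"
proof -
  interpret IS_cat C I S
    using assms by unfold_locales (auto simp: IS_category_def)
  show ?thesis
    using ordered_category_I_order ordered_category_with_restrictions_K left_cancellative_K
      constellation_with_range_Q left_cancellative_Q canonical_radiant_surjection_part
      category_iso_\<psi> \<psi>_S \<psi>_I
    by auto
qed

end
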